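(* Let $X$ be a nonempty topological space and $A(X)$ a subring of $F(X)$ such that for every $f\in A(X)$: $f$ is a unit of $A(X)$ if and only if $Z(f)=\emptyset$. Then the following hold. (1) If $X$ is compact, then every proper ideal in $A(X)$ is pseudofixed. (2) Suppose $X$ is a completely regular Hausdorff space and $C(X)\subseteq A(X)$. If every proper ideal in $A(X)$ is pseudofixed, then $X$ is compact.
   Context: $F(X)$ is the ring of all functions $X\to\mathbb{R}$ with pointwise operations and $C(X)$ its subring of continuous functions. For $f\in F(X)$, $Z(f)=\{x\in X: f(x)=0\}$. A proper ideal $I$ of a subring $A(X)$ of $F(X)$ is called pseudofixed if $\bigcap_{f\in I}\overline{Z(f)}\neq\emptyset$, where the bar denotes closure in $X$. *)

theory Defs
  imports "HOL-Analysis.Analysis" "HOL-Algebra.Subrings" "HOL-Algebra.Ideal"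
begin

(* Functions on X are represented by extensional functions on topspace X, so that equality
   in the carrier is equality of functions on the space. *)
definition fun_ring :: "'a topology \<Rightarrow> ('a \<Rightarrow> real) ring" where
  "fun_ring X =
     \<lparr>carrier = topspace X \<rightarrow>\<^sub>E UNIV,
      mult = (\<lambda>f g. \<lambda>x\<in>topspace X. f x * g x),
      one = (\<lambda>x\<in>topspace X. 1),
      zero = (\<lambda>x\<in>topspace X. 0),
      add = (\<lambda>f g. \<lambda>x\<in>topspace X. f x + g x)\<rparr>"

definition cont_funs :: "'a topology \<Rightarrow> ('a \<Rightarrow> real) set" where
  "cont_funs X = {f \<in> carrier (fun_ring X). continuous_map X euclideanreal f}"

definition zero_set :: "'a topology \<Rightarrow> ('a \<Rightarrow> real) \<Rightarrow> 'a set" where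
  "zero_set X f = {x \<in> topspace X. f x = 0}"

definition proper_ideal :: "'b set \<Rightarrow> ('b, 'c) ring_scheme \<Rightarrow> bool" where
  "proper_ideal I R \<longleftrightarrow> ideal I R \<and> I \<noteq> carrier R"

(* An ideal is nonempty, so the intersection is a subset of topspace X. *)
definition pseudofixed :: "'a topology \<Rightarrow> ('a \<Rightarrow> real) set \<Rightarrow> bool" where
  "pseudofixed X I \<longleftrightarrow> (\<Inter>f\<in>I. X closure_of zero_set X f) \<noteq> {}"

lemma fun_ring_cring: "cring (fun_ring X)"
proof (rule cringI)
  show "abelian_group (fun_ring X)"
  proof (rule abelian_groupI)
    fix f assume "f \<in> carrier (fun_ring X)"
    then show "\<exists>g\<in>carrier (fun_ring X). g \<oplus>\<^bsub>fun_ring X\<^esub> f = \<zero>\<^bsub>fun_ring X\<^esub>"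
      by (intro bexI[where x = "\<lambda>x\<in>topspace X. - f x"]) (auto simp: fun_ring_def)
  qed (auto simp: fun_ring_def fun_eq_iff PiE_iff extensional_def)
  show "Group.comm_monoid (fun_ring X)"
    by (rule comm_monoidI) (auto simp: fun_ring_def fun_eq_iff PiE_iff extensional_def)
qed (auto simp: fun_ring_def fun_eq_iff PiE_iff extensional_def algebra_simps)

end

theory Submission
  imports Defs
begin

text \<open>(1) For \<open>f, g\<close> in an ideal, \<open>f\<^sup>2 + g\<^sup>2\<close> is in the ideal and has zero set
  \<open>Z(f) \<inter> Z(g)\<close>. A proper ideal contains no unit, so its zero sets have the finite intersection
  property, and so do their closures.

  (2) An open cover without finite subcover yields a proper ideal: the functions of the ring that
  vanish off the union of some finite part of the cover. Were the closures of its zero sets to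
  meet in a point \<open>p\<close>, a continuous function with value 1 at \<open>p\<close> vanishing off a member of the cover
  containing \<open>p\<close> would give a contradiction.\<close>

lemma fun_ring_sel:
  "carrier (fun_ring X) = topspace X \<rightarrow>\<^sub>E UNIV"
  "f \<otimes>\<^bsub>fun_ring X\<^esub> g = (\<lambda>x\<in>topspace X. f x * g x)"
  "f \<oplus>\<^bsub>fun_ring X\<^esub> g = (\<lambda>x\<in>topspace X. f x + g x)"
  "\<one>\<^bsub>fun_ring X\<^esub> = (\<lambda>x\<in>topspace X. 1)"
  "\<zero>\<^bsub>fun_ring X\<^esub> = (\<lambda>x\<in>topspace X. 0)"
  by (simp_all add: fun_ring_def)

lemma (in ideal) carrier_if_unit:
  assumes "u \<in> I" "u \<in> Units R"
  shows "I = carrier R"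
  using assms I_l_closed[of u "inv u"] one_imp_carrier by simp

text \<open>Induction on \<open>F\<close>: for a singleton its element serves as witness, and a
  further \<open>f\<close> is merged with the \<open>g\<close> found so far through a sum of
  squares, which over the reals vanishes only where both do. The inclusion suffices later, because
  the single witness \<open>g\<close> in a proper ideal must have a zero.\<close>

lemma finite_zero_set_Inter:
  assumes I: "ideal I ((fun_ring X)\<lparr>carrier := A\<rparr>)"
    and "finite F" "F \<noteq> {}" "F \<subseteq> I"
  shows "\<exists>g\<in>I. zero_set X g \<subseteq> (\<Inter>f\<in>F. zero_set X f)"
  using assms(2-)
proof (induction F rule: finite_ne_induct)
  case (insert f F)
  interpret ideal I "(fun_ring X)\<lparr>carrier := A\<rparr>" by (rule I)
  from insert obtain g where g: "g \<in> I" "zero_set X g \<subseteq> (\<Inter>f\<in>F. zero_set X f)"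
    by auto
  let ?h = "(f \<otimes>\<^bsub>fun_ring X\<^esub> f) \<oplus>\<^bsub>fun_ring X\<^esub> (g \<otimes>\<^bsub>fun_ring X\<^esub> g)"
  have "f \<in> I" using insert by simp
  then have "?h \<in> I"
    using g I_l_closed[of f f] I_l_closed[of g g] Icarr
      additive_subgroup.a_closed[OF additive_subgroup_axioms] by force
  moreover have "zero_set X ?h \<subseteq> zero_set X f \<inter> zero_set X g"
    by (auto simp: zero_set_def fun_ring_sel sum_squares_eq_zero_iff)
  ultimately show ?case using g by blast
qed auto

lemma compact_space_imp_pseudofixed:
  assumes "compact_space X"
    and unit: "\<And>f. f \<in> A \<Longrightarrow> zero_set X f = {} \<Longrightarrow>
                 f \<in> Units ((fun_ring X)\<lparr>carrier := A\<rparr>)"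
    and "proper_ideal I ((fun_ring X)\<lparr>carrier := A\<rparr>)"
  shows "pseudofixed X I"
proof -
  have id: "ideal I ((fun_ring X)\<lparr>carrier := A\<rparr>)" and ne: "I \<noteq> A"
    using assms(3) by (auto simp: proper_ideal_def)
  interpret ideal I "(fun_ring X)\<lparr>carrier := A\<rparr>" by (rule id)
  have nonempty: "zero_set X g \<noteq> {}" if "g \<in> I" for g
    using that unit[of g] carrier_if_unit[of g] ne Icarr[of g] by auto
  have "\<Inter>((\<lambda>f. X closure_of zero_set X f) ` F) \<noteq> {}" if F: "finite F" "F \<subseteq> I" for F
  \<comment> \<open>For empty \<open>F\<close> the intersection is \<open>UNIV\<close>. Otherwise
    any zero of the witness \<open>g\<close> lies in every \<open>zero_set X f\<close> and hence in
    every closure.\<close>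
  proof (cases "F = {}")
    case False
    then obtain g where g: "g \<in> I" "zero_set X g \<subseteq> (\<Inter>f\<in>F. zero_set X f)"
      using finite_zero_set_Inter[OF id] F by blast
    moreover have "zero_set X f \<subseteq> X closure_of zero_set X f" for f
      by (intro closure_of_subset) (auto simp: zero_set_def)
    ultimately show ?thesis using nonempty[OF g(1)] by blast
  qed auto
  \<comment> \<open>Closures are closed, so the finite intersection form of compactness yields a
    point common to all of them.\<close>
  then show ?thesis
    using assms(1) unfolding compact_space_fip pseudofixed_def
    by (auto simp: all_finite_subset_image)
qed

text \<open>Finite parts of \<open>\<U>\<close> are directed under union: if \<open>f\<close>
  vanishes off \<open>\<Union>F\<close> and \<open>g\<close> off \<open>\<Union>G\<close>, their sum
  vanishes off \<open>\<Union>(F \<union> G)\<close>. A multiple of \<open>f\<close> vanishes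
  wherever \<open>f\<close> does, so the same \<open>F\<close> serves.\<close>

lemma ideal_vanishing_off_finite_Union:
  assumes A: "subring A (fun_ring X)"
  shows "ideal {f \<in> A. \<exists>F. finite F \<and> F \<subseteq> \<U> \<and> (\<forall>x\<in>topspace X - \<Union>F. f x = 0)}
               ((fun_ring X)\<lparr>carrier := A\<rparr>)" (is "ideal ?I ?R")
proof -
  interpret fr: cring "fun_ring X" by (rule fun_ring_cring)
  interpret R: ring ?R by (rule fr.subring_is_ring[OF A])
  note sub = subringE[OF A]
  \<comment> \<open>A subring is closed under the abstract negation of \<open>fun_ring X\<close>;
    uniqueness of additive inverses makes this pointwise negation, whose zeros are those of
    \<open>f\<close>.\<close>
  have neg: "(\<lambda>x\<in>topspace X. - f x) \<in> A" if "f \<in> A" for f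
  proof -
    have "\<ominus>\<^bsub>fun_ring X\<^esub> f = (\<lambda>x\<in>topspace X. - f x)"
      using that sub(1) by (intro fr.minus_equality) (auto simp: fun_ring_sel)
    with sub(5)[OF that] show ?thesis by simp
  qed
  show ?thesis
  proof (rule idealI[OF R.ring_axioms])
    show "subgroup ?I (add_monoid ?R)"
    proof (rule group.subgroupI[OF R.a_group])
      show "?I \<noteq> {}"
        using sub(2) by (force simp: fun_ring_sel)
      fix f assume f: "f \<in> ?I"
      then have "f \<in> A" by simp
      then have "inv\<^bsub>add_monoid ?R\<^esub> f = (\<lambda>x\<in>topspace X. - f x)"
        using neg[of f] by (intro group.inv_equality[OF R.a_group]) (auto simp: fun_ring_sel)
      moreover obtain F where "finite F" "F \<subseteq> \<U>" "\<forall>x\<in>topspace X - \<Union>F. f x = 0"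
        using f by blast
      ultimately show "inv\<^bsub>add_monoid ?R\<^esub> f \<in> ?I"
        using neg[OF \<open>f \<in> A\<close>] by (auto intro!: exI[of _ F])
    next
      fix f g assume "f \<in> ?I" "g \<in> ?I"
      then obtain F G where "f \<in> A" "g \<in> A"
        and "finite F" "F \<subseteq> \<U>" "\<forall>x\<in>topspace X - \<Union>F. f x = 0"
        and "finite G" "G \<subseteq> \<U>" "\<forall>x\<in>topspace X - \<Union>G. g x = 0"
        by blast
      then show "f \<otimes>\<^bsub>add_monoid ?R\<^esub> g \<in> ?I"
        using sub(7)[of f g] by (auto simp: fun_ring_sel intro!: exI[of _ "F \<union> G"])
    qed auto
  qed (use sub(6) in \<open>force simp: fun_ring_sel\<close>)+
qed

lemma pseudofixed_imp_compact_space: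
  assumes A: "subring A (fun_ring X)" "cont_funs X \<subseteq> A"
    and reg: "completely_regular_space X"
    and pf: "\<And>I. proper_ideal I ((fun_ring X)\<lparr>carrier := A\<rparr>) \<Longrightarrow> pseudofixed X I"
  shows "compact_space X"
  unfolding compact_space_alt
proof (intro allI impI, elim conjE, rule ccontr)
  fix \<U> assume op: "\<forall>U\<in>\<U>. openin X U" and cover: "topspace X \<subseteq> \<Union>\<U>"
    and no: "\<nexists>\<F>. finite \<F> \<and> \<F> \<subseteq> \<U> \<and> topspace X \<subseteq> \<Union>\<F>"
  define I where "I = {f \<in> A. \<exists>F. finite F \<and> F \<subseteq> \<U> \<and> (\<forall>x\<in>topspace X - \<Union>F. f x = 0)}"
  \<comment> \<open>The constant 1 can vanish off a finite union only if nothing of \<open>X\<close>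
    is left over, which would give a finite subcover.\<close>
  have "\<one>\<^bsub>fun_ring X\<^esub> \<notin> I"
  proof
    assume "\<one>\<^bsub>fun_ring X\<^esub> \<in> I"
    then obtain F where F: "finite F" "F \<subseteq> \<U>"
      and one: "\<forall>x\<in>topspace X - \<Union>F. \<one>\<^bsub>fun_ring X\<^esub> x = 0"
      unfolding I_def by blast
    from one have "topspace X \<subseteq> \<Union>F"
      by (force simp: fun_ring_sel)
    with F no show False by blast
  qed
  moreover have "\<one>\<^bsub>fun_ring X\<^esub> \<in> A"
    using subringE(3)[OF A(1)] .
  moreover have "ideal I ((fun_ring X)\<lparr>carrier := A\<rparr>)"
    unfolding I_def by (rule ideal_vanishing_off_finite_Union[OF A(1)])
  ultimately have "proper_ideal I ((fun_ring X)\<lparr>carrier := A\<rparr>)"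
    by (auto simp: proper_ideal_def)
  from pf[OF this] obtain p where p: "\<And>f. f \<in> I \<Longrightarrow> p \<in> X closure_of zero_set X f"
    by (auto simp: pseudofixed_def)
  \<comment> \<open>A member of \<open>I\<close> is needed to place \<open>p\<close> in
    \<open>X\<close>, as closures lie in \<open>topspace X\<close>.\<close>
  have "\<zero>\<^bsub>fun_ring X\<^esub> \<in> I"
    using subringE(2)[OF A(1)] unfolding I_def
    by (auto simp: fun_ring_sel intro!: exI[of _ "{}"])
  from p[OF this] have pX: "p \<in> topspace X"
    using closure_of_subset_topspace by fast
  then obtain U where U: "U \<in> \<U>" "p \<in> U" using cover by blast
  then have "openin X U" using op by blast
  then obtain g :: "'a \<Rightarrow> real" where g: "continuous_map X euclideanreal g" "g p = 0"
      "g ` (topspace X - U) \<subseteq> {1}"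
    using reg U(2) unfolding completely_regular_space_alt' by blast
  \<comment> \<open>Complete regularity gives the value 0 at \<open>p\<close> and 1 off
    \<open>U\<close>; membership in \<open>I\<close>, with the finite part \<open>{U}\<close>,
    requires the values the other way round.\<close>
  define f where "f = (\<lambda>x. 1 - g x)"
  have f: "continuous_map X euclideanreal f" "f p = 1" "f ` (topspace X - U) \<subseteq> {0}"
    using g by (auto simp: f_def intro!: continuous_map_diff)
  \<comment> \<open>Elements of the ring are extensional, hence the restriction.\<close>
  let ?f = "restrict f (topspace X)"
  have cont: "continuous_map X euclideanreal ?f"
    using f(1) by (rule continuous_map_eq) simp
  have "?f \<in> I"
    using A(2) cont U f(3) unfolding I_def
    by (auto simp: cont_funs_def fun_ring_sel intro!: exI[of _ "{U}"])
  then have "p \<in> X closure_of zero_set X ?f" by (rule p)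
  \<comment> \<open>By continuity the zero set is its own closure, so \<open>p\<close> would be a
    zero of \<open>?f\<close>, although the value there is 1.\<close>
  moreover have "closedin X (zero_set X ?f)"
    using closedin_continuous_map_preimage[OF cont, of "{0}"] by (simp add: zero_set_def)
  ultimately show False
    using f(2) pX by (simp add: closure_of_closedin zero_set_def)
qed

theorem proposition3p10:
  fixes X :: "'a topology" and A :: "('a \<Rightarrow> real) set"
  assumes "topspace X \<noteq> {}"
    and "subring A (fun_ring X)"
    and "\<And>f. f \<in> A \<Longrightarrow>
           f \<in> Units ((fun_ring X)\<lparr>carrier := A\<rparr>) \<longleftrightarrow> zero_set X f = {}"
  shows "(compact_space X \<longrightarrow>
            (\<forall>I. proper_ideal I ((fun_ring X)\<lparr>carrier := A\<rparr>) \<longrightarrow> pseudofixed X I)) \<and>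
         (completely_regular_space X \<and> Hausdorff_space X \<and> cont_funs X \<subseteq> A \<longrightarrow>
            (\<forall>I. proper_ideal I ((fun_ring X)\<lparr>carrier := A\<rparr>) \<longrightarrow> pseudofixed X I) \<longrightarrow>
            compact_space X)"
proof (intro conjI impI allI)
  fix I assume "compact_space X" and I: "proper_ideal I ((fun_ring X)\<lparr>carrier := A\<rparr>)"
  show "pseudofixed X I"
    by (rule compact_space_imp_pseudofixed[OF \<open>compact_space X\<close> _ I]) (simp add: assms(3))
next
  assume *: "completely_regular_space X \<and> Hausdorff_space X \<and> cont_funs X \<subseteq> A"
    and pf: "\<forall>I. proper_ideal I ((fun_ring X)\<lparr>carrier := A\<rparr>) \<longrightarrow> pseudofixed X I"
  show "compact_space X"
    by (rule pseudofixed_imp_compact_space[OF assms(2)]) (use * pf in blast)+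
qed

end
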